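(* For every integer $q>3$ there is, up to graph isomorphism, a unique Platonic $q$-sphere.
   Context: All graphs are finite simple graphs; $S(v)$ is the subgraph induced by the neighbors of the vertex $v$ and $G\setminus v$ is the graph with $v$ removed. Contractible graphs: the one-point graph $K_1$ is contractible, and $G$ is contractible if there is a vertex $v$ such that both $S(v)$ and $G\setminus v$ are contractible; the empty graph is not contractible. The empty graph is the $(-1)$-sphere; for $q\ge 0$, a $q$-manifold is a graph all of whose unit spheres $S(v)$ are $(q-1)$-spheres, and a $q$-sphere is a $q$-manifold for which there is a vertex $v$ such that $G\setminus v$ is contractible. Platonic spheres are defined inductively: the empty graph ($(-1)$-sphere) is Platonic; for $q\ge 0$ a $q$-sphere is Platonic if all its unit spheres $S(v)$ are Platonic $(q-1)$-spheres and are all isomorphic to each other. *)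

theory Defs
  imports "Graph_Theory.Digraph_Isomorphism"
begin

text \<open>
  A finite simple graph is a digraph satisfying the locale predicate \<^const>\<open>graph\<close>: finite,
  symmetric, without loops or parallel arcs. The empty graph is allowed. Every predicate below
  includes this condition.
\<close>

definition unit_sphere :: "('a,'b) pre_digraph \<Rightarrow> 'a \<Rightarrow> ('a,'b) pre_digraph" where
  "unit_sphere G v = G \<restriction> {w. v \<rightarrow>\<^bsub>G\<^esub> w}"

inductive contractible :: "('a,'b) pre_digraph \<Rightarrow> bool" where
  one_point: "graph G \<Longrightarrow> card (verts G) = 1 \<Longrightarrow> contractible G"
| extend: "graph G \<Longrightarrow> v \<in> verts G \<Longrightarrow> contractible (unit_sphere G v) \<Longrightarrow>
    contractible (pre_digraph.del_vert G v) \<Longrightarrow> contractible G"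

text \<open>The dimension is an integer, since the recursion starts with the \<open>(-1)\<close>-sphere.\<close>

inductive q_manifold :: "int \<Rightarrow> ('a,'b) pre_digraph \<Rightarrow> bool"
  and q_sphere :: "int \<Rightarrow> ('a,'b) pre_digraph \<Rightarrow> bool" where
  sphere_empty: "graph G \<Longrightarrow> verts G = {} \<Longrightarrow> q_sphere (-1) G"
| manifold: "graph G \<Longrightarrow> q \<ge> 0 \<Longrightarrow>
    \<forall>v\<in>verts G. q_sphere (q - 1) (unit_sphere G v) \<Longrightarrow> q_manifold q G"
| sphere: "q_manifold q G \<Longrightarrow> v \<in> verts G \<Longrightarrow>
    contractible (pre_digraph.del_vert G v) \<Longrightarrow> q_sphere q G"

inductive platonic_sphere :: "int \<Rightarrow> ('a,'b) pre_digraph \<Rightarrow> bool" where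
  platonic_empty: "graph G \<Longrightarrow> verts G = {} \<Longrightarrow> platonic_sphere (-1) G"
| platonic: "q \<ge> 0 \<Longrightarrow> q_sphere q G \<Longrightarrow>
    \<forall>v\<in>verts G. platonic_sphere (q - 1) (unit_sphere G v) \<Longrightarrow>
    \<forall>v\<in>verts G. \<forall>w\<in>verts G. digraph_iso (unit_sphere G v) (unit_sphere G w) \<Longrightarrow>
    platonic_sphere q G"

end

theory Submission
  imports Defs
begin

text \<open>
  The unique Platonic \<open>q\<close>-sphere is the cross polytope. If all unit spheres of a connected graph
  are cross polytopes of dimension at least one, then all neighbours of a vertex \<open>v\<close> share a single
  further neighbour outside the unit ball of \<open>v\<close>, which makes the graph a cross polytope.
  So only low dimensions matter. Counting cliques in unit spheres and comparing with the Euler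
  characteristic leaves for a Platonic 2-sphere the octahedron or the clique counts of the
  icosahedron. In the second case the clique counts of a 3-sphere are determined up to the number
  of its vertices, and for a 4-sphere the Euler characteristic becomes the number of vertices,
  which would have to be 2.
\<close>

section \<open>Adjacency, induced subgraphs and vertex deletion\<close>

lemma graph_dominatesD:
  assumes "graph G" "x \<rightarrow>\<^bsub>G\<^esub> y"
  shows "x \<in> verts G" "y \<in> verts G" "x \<noteq> y" "y \<rightarrow>\<^bsub>G\<^esub> x"
proof -
  interpret graph G by fact
  show "x \<in> verts G" "y \<in> verts G"
    using assms(2) by (auto simp: adj_in_verts)
  show "x \<noteq> y"
    using assms(2) adj_not_same by blast
  show "y \<rightarrow>\<^bsub>G\<^esub> x"
    using assms(2) sym_arcs by (rule arcs_ends_symmetric[rotated])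
qed

lemma graph_irrefl: "graph G \<Longrightarrow> \<not> v \<rightarrow>\<^bsub>G\<^esub> v"
  using graph_dominatesD(3) by metis

lemma graph_finite_verts: "graph G \<Longrightarrow> finite (verts G)"
  by (simp add: graph_def digraph_def fin_digraph.finite_verts)

lemma graph_induce:
  assumes "graph G" "S \<subseteq> verts G"
  shows "graph (G \<restriction> S)"
proof -
  interpret graph G by fact
  have s: "\<exists>e2\<in>arcs G. tail G e = head G e2 \<and> head G e = tail G e2" if "e \<in> arcs G" for e
    using sym_arcs that by (auto simp: symmetric_conv)
  have "symmetric (G \<restriction> S)"
    unfolding symmetric_conv using s by fastforce
  then show ?thesis
    using finite_subset[OF assms(2)] no_loops no_multi_arcs
    by unfold_locales (auto simp: arc_to_ends_def)
qed

lemma del_vert_eq_induce: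
  assumes "graph G"
  shows "pre_digraph.del_vert G v = G \<restriction> (verts G - {v})"
proof -
  interpret graph G by fact
  show ?thesis
    by (auto simp: del_vert_def induce_subgraph_def)
qed

lemma graph_unit_sphere: "graph G \<Longrightarrow> graph (unit_sphere G v)"
  unfolding unit_sphere_def by (rule graph_induce) (auto dest: graph_dominatesD)

lemma graph_del_vert: "graph G \<Longrightarrow> graph (pre_digraph.del_vert G v)"
  by (simp add: del_vert_eq_induce graph_induce)

lemma dominates_induce_iff: "x \<rightarrow>\<^bsub>G \<restriction> S\<^esub> y \<longleftrightarrow> x \<in> S \<and> y \<in> S \<and> x \<rightarrow>\<^bsub>G\<^esub> y"
  by (auto simp: arcs_ends_conv)

lemma verts_unit_sphere: "verts (unit_sphere G v) = {w. v \<rightarrow>\<^bsub>G\<^esub> w}"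
  by (simp add: unit_sphere_def)

lemma dominates_unit_sphere:
  "x \<rightarrow>\<^bsub>unit_sphere G v\<^esub> y \<longleftrightarrow> v \<rightarrow>\<^bsub>G\<^esub> x \<and> v \<rightarrow>\<^bsub>G\<^esub> y \<and> x \<rightarrow>\<^bsub>G\<^esub> y"
  by (simp add: unit_sphere_def dominates_induce_iff)

lemma dominates_del_vert:
  "x \<rightarrow>\<^bsub>pre_digraph.del_vert G v\<^esub> y \<longleftrightarrow> x \<noteq> v \<and> y \<noteq> v \<and> x \<rightarrow>\<^bsub>G\<^esub> y"
  by (auto simp: arcs_ends_conv pre_digraph.del_vert_simps)

section \<open>Unfolding manifolds, spheres and Platonic spheres\<close>

lemma q_manifoldD:
  assumes "q_manifold q G"
  shows "graph G" "q \<ge> 0" "\<And>v. v \<in> verts G \<Longrightarrow> q_sphere (q - 1) (unit_sphere G v)"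
  using assms by (cases rule: q_manifold.cases; blast)+

text \<open>The rule \<open>sphere\<close> states no bound on \<open>q\<close>; the bound is
  inherited from \<open>q_manifold\<close> and separates the empty sphere from all others.\<close>

lemma q_sphere_cases:
  assumes "q_sphere q G"
  obtains "q = -1" "graph G" "verts G = {}"
  | v where "q \<ge> 0" "q_manifold q G" "v \<in> verts G" "contractible (pre_digraph.del_vert G v)"
  using assms
proof (cases rule: q_sphere.cases)
  case sphere_empty
  then show ?thesis using that(1) by simp
next
  case (sphere v)
  then show ?thesis using that(2) q_manifoldD(2) by blast
qed

lemma q_sphereE:
  assumes "q_sphere q G" "q \<ge> 0"
  obtains v where "q_manifold q G" "v \<in> verts G" "contractible (pre_digraph.del_vert G v)"
  using assms(1)
proof (cases rule: q_sphere_cases)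
  case (2 v)
  then show ?thesis using that by blast
qed (use assms(2) in simp)

lemma q_sphere_minus_oneD:
  assumes "q_sphere (-1) G"
  shows "verts G = {}"
  using assms by (cases rule: q_sphere_cases) simp_all

lemma q_sphere_graph:
  assumes "q_sphere q G"
  shows "graph G"
  using assms by (cases rule: q_sphere_cases) (simp_all add: q_manifoldD(1))

lemma q_sphere_links:
  assumes "q_sphere q G" "v \<in> verts G"
  shows "q_sphere (q - 1) (unit_sphere G v)"
  using assms(1)
proof (cases rule: q_sphere_cases)
  case 1
  then show ?thesis using assms(2) by simp
next
  case 2
  then show ?thesis using q_manifoldD(3)[OF 2(2) assms(2)] by simp
qed

lemma platonic_sphereD:
  assumes "platonic_sphere q G" "q \<ge> 0"
  shows "\<And>v. v \<in> verts G \<Longrightarrow> platonic_sphere (q - 1) (unit_sphere G v)"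
    "\<And>v w. v \<in> verts G \<Longrightarrow> w \<in> verts G \<Longrightarrow> digraph_iso (unit_sphere G v) (unit_sphere G w)"
  using assms(1) by (cases rule: platonic_sphere.cases; use assms(2) in simp)+

lemma platonic_q_sphere:
  assumes "platonic_sphere q G"
  shows "q_sphere q G"
  using assms by (cases rule: platonic_sphere.cases) (simp_all add: sphere_empty)


section \<open>Isomorphisms\<close>

text \<open>This forgets the arc part of an isomorphism. The relation \<open>arcs_ends H\<close> is
  the image of \<open>arcs_ends G\<close> under the vertex map on pairs, and injectivity there lets
  membership be pulled back.\<close>

lemma digraph_iso_imp_bij:
  assumes "digraph_iso G H"
  obtains f where "bij_betw f (verts G) (verts H)"
    "\<And>x y. x \<in> verts G \<Longrightarrow> y \<in> verts G \<Longrightarrow> f x \<rightarrow>\<^bsub>H\<^esub> f y \<longleftrightarrow> x \<rightarrow>\<^bsub>G\<^esub> y"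
proof -
  from assms obtain h where h: "pre_digraph.digraph_isomorphism G h" and H: "H = app_iso h G"
    by (auto simp: digraph_iso_def)
  have wf: "wf_digraph G" and inj: "inj_on (iso_verts h) (verts G)"
    and ends: "\<And>a. a \<in> arcs G \<Longrightarrow> iso_tail h (iso_arcs h a) = iso_verts h (tail G a)"
    "\<And>a. a \<in> arcs G \<Longrightarrow> iso_head h (iso_arcs h a) = iso_verts h (head G a)"
    using h by (auto simp: pre_digraph.digraph_isomorphism_def)
  show ?thesis
  proof
    show "bij_betw (iso_verts h) (verts G) (verts H)"
      using inj by (simp add: H bij_betw_def)
  next
    fix x y assume xy: "x \<in> verts G" "y \<in> verts G"
    have "arcs_ends H = map_prod (iso_verts h) (iso_verts h) ` arcs_ends G"
      by (force simp: arcs_ends_conv H ends)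
    moreover have "inj_on (map_prod (iso_verts h) (iso_verts h)) (verts G \<times> verts G)"
      by (rule map_prod_inj_on[OF inj inj])
    moreover have "arcs_ends G \<subseteq> verts G \<times> verts G"
      using wf by (auto simp: arcs_ends_conv wf_digraph_def)
    ultimately show "iso_verts h x \<rightarrow>\<^bsub>H\<^esub> iso_verts h y \<longleftrightarrow> x \<rightarrow>\<^bsub>G\<^esub> y"
      using xy inj_on_image_mem_iff[of "map_prod (iso_verts h) (iso_verts h)" _ "(x, y)" "arcs_ends G"]
      by simp
  qed
qed

text \<open>Without parallel arcs the arc map is forced: an arc of \<open>G\<close> must go to the
  only arc of \<open>H\<close> whose ends are the images of its ends.\<close>

lemma bij_imp_digraph_iso:
  assumes G: "graph G" and H: "graph H" and bij: "bij_betw f (verts G) (verts H)"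
    and adj: "\<And>x y. x \<in> verts G \<Longrightarrow> y \<in> verts G \<Longrightarrow> f x \<rightarrow>\<^bsub>H\<^esub> f y \<longleftrightarrow> x \<rightarrow>\<^bsub>G\<^esub> y"
  shows "digraph_iso G H"
proof -
  interpret G: graph G by fact
  interpret H: graph H by fact
  let ?e = "\<lambda>a. (f (tail G a), f (head G a))"
  define g where "g a = the_inv_into (arcs H) (arc_to_ends H) (?e a)" for a
  have injH: "inj_on (arc_to_ends H) (arcs H)" by (rule H.inj_on_arc_to_ends)
  have ends: "?e ` arcs G = arcs_ends H"
  proof
    show "?e ` arcs G \<subseteq> arcs_ends H"
      using adj by (auto simp: arcs_ends_conv)
    show "arcs_ends H \<subseteq> ?e ` arcs G"
    proof
      fix p assume p: "p \<in> arcs_ends H"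
      then obtain x y where xy: "p = (f x, f y)" "x \<in> verts G" "y \<in> verts G"
        using bij graph_dominatesD(1,2)[OF H] unfolding bij_betw_def by (metis imageE prod.collapse)
      then have "x \<rightarrow>\<^bsub>G\<^esub> y" using adj p by auto
      then show "p \<in> ?e ` arcs G" using xy by (auto simp: arcs_ends_conv)
    qed
  qed
  have inj: "inj_on ?e (arcs G)"
    using bij by (auto simp: inj_on_def bij_betw_def arc_to_ends_def intro!: G.no_multi_arcs)
  have g: "g a \<in> arcs H \<and> arc_to_ends H (g a) = ?e a" if "a \<in> arcs G" for a
  proof -
    have "?e a \<in> arc_to_ends H ` arcs H"
      using ends that by (auto simp: arcs_ends_def)
    then show ?thesis
      unfolding g_def using injH by (metis f_the_inv_into_f the_inv_into_into order_refl)
  qed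
  have inj_g: "inj_on g (arcs G)"
    using inj g by (metis (no_types, lifting) inj_on_def)
  have surj: "g ` arcs G = arcs H"
  proof
    show "g ` arcs G \<subseteq> arcs H" using g by auto
    show "arcs H \<subseteq> g ` arcs G"
    proof
      fix b assume b: "b \<in> arcs H"
      then have "arc_to_ends H b \<in> ?e ` arcs G" using ends by (auto simp: arcs_ends_def)
      then obtain a where "a \<in> arcs G" "arc_to_ends H b = ?e a" by auto
      then show "b \<in> g ` arcs G" using g b H.no_multi_arcs by (metis image_eqI)
    qed
  qed
  \<comment> \<open>\<open>digraph_iso\<close> demands equality of records, hence of the total
    functions \<open>head\<close> and \<open>tail\<close>. Taking them from \<open>H\<close> itself
    secures this even outside the arcs.\<close>
  let ?h = "\<lparr>iso_verts = f, iso_arcs = g, iso_head = head H, iso_tail = tail H\<rparr>"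
  have "pre_digraph.digraph_isomorphism G ?h"
    using bij inj_g g by (auto simp: pre_digraph.digraph_isomorphism_def bij_betw_def arc_to_ends_def
        G.wf_digraph)
  moreover have "H = app_iso ?h G"
    using bij surj by (simp add: app_iso_def bij_betw_def)
  ultimately show ?thesis unfolding digraph_iso_def by blast
qed


section \<open>Clique counts and Euler characteristic\<close>

definition cliques :: "('a,'b) pre_digraph \<Rightarrow> 'a set set" where
  "cliques G = {K. K \<subseteq> verts G \<and> (\<forall>x\<in>K. \<forall>y\<in>K. x \<noteq> y \<longrightarrow> x \<rightarrow>\<^bsub>G\<^esub> y)}"

text \<open>The index is the number of vertices, so a simplex of dimension \<open>d\<close> is
  counted at \<open>k = d + 1\<close>, and the empty clique at \<open>k = 0\<close>.\<close>

definition num_cliques :: "nat \<Rightarrow> ('a,'b) pre_digraph \<Rightarrow> nat" where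
  "num_cliques k G = card {K \<in> cliques G. card K = k}"

text \<open>The negative of the reduced Euler characteristic of the clique complex: the empty clique
  is counted.\<close>

definition euler :: "('a,'b) pre_digraph \<Rightarrow> int" where
  "euler G = (\<Sum>K\<in>cliques G. (-1) ^ card K)"

lemma finite_cliques: "graph G \<Longrightarrow> finite (cliques G)"
  using graph_finite_verts[of G] unfolding cliques_def by auto

lemma clique_finite: "graph G \<Longrightarrow> K \<in> cliques G \<Longrightarrow> finite K"
  using graph_finite_verts[of G] unfolding cliques_def by (auto intro: finite_subset)

lemma cliques_del_vert: "cliques (pre_digraph.del_vert G v) = {K \<in> cliques G. v \<notin> K}"
  unfolding cliques_def by (auto simp: dominates_del_vert pre_digraph.del_vert_simps)

text \<open>Removing \<open>v\<close> from a clique leaves pairwise adjacent neighbours of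
  \<open>v\<close>. Both the Euler recursion and the double counting of cliques rest on this
  bijection.\<close>

lemma cliques_containing:
  assumes "graph G" "v \<in> verts G"
  shows "bij_betw (insert v) (cliques (unit_sphere G v)) {K \<in> cliques G. v \<in> K}"
proof (rule bij_betwI[where g = "\<lambda>K. K - {v}"])
  show "insert v \<in> cliques (unit_sphere G v) \<rightarrow> {K \<in> cliques G. v \<in> K}"
    using assms by (fastforce simp: cliques_def verts_unit_sphere dominates_unit_sphere
      dest: graph_dominatesD)
  show "(\<lambda>K. K - {v}) \<in> {K \<in> cliques G. v \<in> K} \<rightarrow> cliques (unit_sphere G v)"
    by (auto simp: cliques_def verts_unit_sphere dominates_unit_sphere)
  have "v \<notin> K" if "K \<in> cliques (unit_sphere G v)" for K
    using that graph_dominatesD(3)[OF assms(1)] by (auto simp: cliques_def verts_unit_sphere)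
  then show "insert v K - {v} = K" if "K \<in> cliques (unit_sphere G v)" for K
    using that by auto
  show "insert v (K - {v}) = K" if "K \<in> {K \<in> cliques G. v \<in> K}" for K
    using that by auto
qed

lemma clique_unit_sphere_card_insert:
  assumes "graph G" "K \<in> cliques (unit_sphere G v)"
  shows "card (insert v K) = Suc (card K)"
proof -
  have "v \<notin> K"
    using assms graph_dominatesD(3)[OF assms(1)] by (auto simp: cliques_def verts_unit_sphere)
  moreover have "finite K"
    by (rule clique_finite[OF graph_unit_sphere[OF assms(1)] assms(2)])
  ultimately show ?thesis by simp
qed

text \<open>Cliques avoiding \<open>v\<close> are those of the graph without \<open>v\<close>. Those
  containing \<open>v\<close> have one vertex more than the corresponding cliques of the unit
  sphere, which flips the sign.\<close>

lemma euler_rec: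
  assumes "graph G" "v \<in> verts G"
  shows "euler G = euler (pre_digraph.del_vert G v) - euler (unit_sphere G v)"
proof -
  have "euler G = (\<Sum>K\<in>{K \<in> cliques G. v \<notin> K}. (-1) ^ card K) + (\<Sum>K\<in>{K \<in> cliques G. v \<in> K}. (-1) ^ card K)"
    unfolding euler_def using finite_cliques[OF assms(1)]
    by (subst sum.union_disjoint[symmetric]) (auto intro!: sum.cong)
  also have "(\<Sum>K\<in>{K \<in> cliques G. v \<in> K}. (-1) ^ card K) =
      (\<Sum>K\<in>cliques (unit_sphere G v). (-1::int) ^ card (insert v K))"
    by (rule sum.reindex_bij_betw[OF cliques_containing[OF assms], symmetric])
  also have "\<dots> = - euler (unit_sphere G v)"
    using clique_unit_sphere_card_insert[OF assms(1)] by (simp add: euler_def sum_negf)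
  finally show ?thesis by (simp add: cliques_del_vert euler_def)
qed

text \<open>For one point the empty clique and the vertex cancel; every extension subtracts zero
  from zero.\<close>

lemma euler_contractible: "contractible G \<Longrightarrow> euler G = 0"
proof (induction rule: contractible.induct)
  case (one_point G)
  then obtain v where "verts G = {v}" by (auto simp: card_1_singleton_iff)
  then have "cliques G = {{}, {v}}" by (auto simp: cliques_def subset_singleton_iff)
  then show ?case by (simp add: euler_def)
next
  case (extend G v)
  then show ?case by (simp add: euler_rec)
qed

text \<open>Some vertex has a contractible complement, which contributes zero, so each dimension
  only changes the sign of the value of a unit sphere. The shift \<open>n = q + 1\<close> lets the
  induction start at the empty sphere.\<close>

lemma euler_sphere: "q_sphere (int n - 1) G \<Longrightarrow> euler G = (-1) ^ n"
proof (induction n arbitrary: G)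
  case 0
  then have "cliques G = {{}}" using q_sphere_minus_oneD[of G] by (auto simp: cliques_def)
  then show ?case by (simp add: euler_def)
next
  case (Suc n)
  then obtain v where "q_manifold (int n) G" and v: "v \<in> verts G" "contractible (pre_digraph.del_vert G v)"
    using q_sphereE[of "int n" G] by auto
  then have "graph G" "q_sphere (int n - 1) (unit_sphere G v)" by (auto dest: q_manifoldD)
  then show ?case using v Suc.IH by (simp add: euler_rec euler_contractible)
qed

lemma num_cliques_0: "graph G \<Longrightarrow> num_cliques 0 G = 1"
proof -
  assume "graph G"
  then have "{K \<in> cliques G. card K = 0} = {{}}"
    by (auto dest: clique_finite simp: cliques_def)
  then show ?thesis by (simp add: num_cliques_def)
qed

lemma num_cliques_1: "num_cliques 1 G = card (verts G)"
proof -
  have "{K \<in> cliques G. card K = 1} = (\<lambda>v. {v}) ` verts G"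
    by (auto simp: cliques_def card_1_singleton_iff)
  then show ?thesis by (simp add: num_cliques_def card_image)
qed

text \<open>Double counting of the pairs of a vertex and a clique of size \<open>Suc k\<close>
  containing it.\<close>

lemma num_cliques_Suc:
  assumes "graph G"
  shows "Suc k * num_cliques (Suc k) G = (\<Sum>v\<in>verts G. num_cliques k (unit_sphere G v))"
proof -
  let ?C = "{K \<in> cliques G. card K = Suc k}"
  have "(\<Sum>v\<in>verts G. num_cliques k (unit_sphere G v)) = (\<Sum>v\<in>verts G. card {K \<in> ?C. v \<in> K})"
  proof (rule sum.cong[OF refl])
    fix v assume v: "v \<in> verts G"
    have b: "bij_betw (insert v) (cliques (unit_sphere G v)) {K \<in> cliques G. v \<in> K}"
      by (rule cliques_containing[OF assms v])
    have "bij_betw (insert v) {K \<in> cliques (unit_sphere G v). card K = k} {K \<in> ?C. v \<in> K}"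
    proof (rule bij_betw_subset[OF b])
      show "insert v ` {K \<in> cliques (unit_sphere G v). card K = k} = {K \<in> ?C. v \<in> K}"
      proof (intro equalityI subsetI)
        fix L assume L: "L \<in> {K \<in> ?C. v \<in> K}"
        then obtain K where "K \<in> cliques (unit_sphere G v)" "L = insert v K"
          using b by (auto simp: bij_betw_def)
        then show "L \<in> insert v ` {K \<in> cliques (unit_sphere G v). card K = k}"
          using L clique_unit_sphere_card_insert[OF assms] by auto
      qed (use b clique_unit_sphere_card_insert[OF assms] in \<open>auto simp: bij_betw_def\<close>)
    qed auto
    then show "num_cliques k (unit_sphere G v) = card {K \<in> ?C. v \<in> K}"
      unfolding num_cliques_def by (rule bij_betw_same_card)
  qed
  also have "\<dots> = Suc k * card ?C"
  proof (rule sum_multicount)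
    show "finite (verts G)" "finite ?C" using graph_finite_verts[OF assms] finite_cliques[OF assms] by auto
    show "\<forall>K\<in>?C. card {v \<in> verts G. v \<in> K} = Suc k"
    proof
      fix K assume K: "K \<in> ?C"
      then have "{v \<in> verts G. v \<in> K} = K" by (auto simp: cliques_def)
      then show "card {v \<in> verts G. v \<in> K} = Suc k" using K by simp
    qed
  qed
  finally show ?thesis by (simp add: num_cliques_def)
qed

text \<open>A clique of size \<open>k\<close> would give one of size \<open>k - 1\<close> in a unit
  sphere, down to a nonempty clique in the empty graph.\<close>

lemma num_cliques_sphere_eq_0:
  "q_sphere (int n - 1) G \<Longrightarrow> n < k \<Longrightarrow> num_cliques k G = 0"
proof (induction n arbitrary: k G)
  case 0
  then have "cliques G = {{}}" using q_sphere_minus_oneD[of G] by (auto simp: cliques_def)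
  then show ?case using 0 by (auto simp: num_cliques_def)
next
  case (Suc n)
  then obtain j where j: "k = Suc j" "n < j" by (cases k) auto
  have "num_cliques j (unit_sphere G v) = 0" if "v \<in> verts G" for v
    using q_sphere_links[OF Suc.prems(1) that] Suc.IH j by simp
  then show ?case
    using num_cliques_Suc[OF q_sphere_graph[OF Suc.prems(1)], of j] j by simp
qed

lemma euler_num_cliques:
  assumes "graph G" "\<And>k. n < k \<Longrightarrow> num_cliques k G = 0"
  shows "euler G = (\<Sum>k\<le>n. (-1) ^ k * int (num_cliques k G))"
proof -
  have fin: "finite (cliques G)" by (rule finite_cliques) fact
  have "card K \<le> n" if "K \<in> cliques G" for K
  proof (rule ccontr)
    assume "\<not> card K \<le> n"
    then have "{L \<in> cliques G. card L = card K} = {}"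
      using assms(2)[of "card K"] fin by (simp add: num_cliques_def)
    then show False using that by blast
  qed
  then have "euler G = (\<Sum>k\<le>n. \<Sum>K | K \<in> cliques G \<and> card K = k. (-1) ^ card K)"
    unfolding euler_def using fin by (subst sum.group) auto
  also have "\<dots> = (\<Sum>k\<le>n. (-1) ^ k * int (num_cliques k G))"
    by (intro sum.cong refl) (simp add: num_cliques_def)
  finally show ?thesis .
qed

lemma sphere_euler_num_cliques:
  assumes "q_sphere (int n - 1) G"
  shows "(\<Sum>k\<le>n. (-1) ^ k * int (num_cliques k G)) = (-1) ^ n"
  using euler_num_cliques[of G n] num_cliques_sphere_eq_0[OF assms] euler_sphere[OF assms]
    q_sphere_graph[OF assms] by simp

lemma card_verts_iso: "digraph_iso G H \<Longrightarrow> card (verts G) = card (verts H)"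
  by (auto simp: bij_betw_same_card elim!: digraph_iso_imp_bij)


section \<open>Connectedness\<close>

text \<open>Closed vertex sets are used instead of paths because connectedness is later applied to
  one explicit set: a vertex, its antipode and their neighbours. The empty graph counts as
  connected.\<close>

definition graph_connected :: "('a,'b) pre_digraph \<Rightarrow> bool" where
  "graph_connected G \<longleftrightarrow> (\<forall>A \<subseteq> verts G. A \<noteq> {} \<longrightarrow>
    (\<forall>x\<in>A. \<forall>y. x \<rightarrow>\<^bsub>G\<^esub> y \<longrightarrow> y \<in> A) \<longrightarrow> A = verts G)"

lemma graph_connectedD:
  assumes "graph_connected G" "A \<subseteq> verts G" "a \<in> A" "\<And>x y. x \<in> A \<Longrightarrow> x \<rightarrow>\<^bsub>G\<^esub> y \<Longrightarrow> y \<in> A"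
  shows "A = verts G"
  using assms unfolding graph_connected_def by blast

text \<open>A nonempty closed set contains a vertex other than \<open>v\<close>, if necessary a
  neighbour of \<open>v\<close>. It therefore contains all other vertices, among them a neighbour of
  \<open>v\<close>, and so \<open>v\<close> itself.\<close>

lemma graph_connected_extend:
  assumes G: "graph G" and v: "v \<in> verts G" and conn: "graph_connected (pre_digraph.del_vert G v)"
    and ne: "verts (unit_sphere G v) \<noteq> {}"
  shows "graph_connected G"
  unfolding graph_connected_def
proof (intro allI impI)
  fix A assume A: "A \<subseteq> verts G" "A \<noteq> {}" "\<forall>x\<in>A. \<forall>y. x \<rightarrow>\<^bsub>G\<^esub> y \<longrightarrow> y \<in> A"
  from ne obtain w where w: "v \<rightarrow>\<^bsub>G\<^esub> w" by (auto simp: verts_unit_sphere)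
  note w' = graph_dominatesD[OF G w]
  have "\<exists>a. a \<in> A \<and> a \<noteq> v"
  proof (cases "v \<in> A")
    case True
    then show ?thesis using A(3) w w'(3) by metis
  qed (use A(2) in blast)
  then obtain a where a: "a \<in> A" "a \<noteq> v" by blast
  have "A - {v} = verts (pre_digraph.del_vert G v)"
  proof (rule graph_connectedD[OF conn, of _ a])
    show "A - {v} \<subseteq> verts (pre_digraph.del_vert G v)"
      using A(1) by (auto simp: pre_digraph.del_vert_simps)
    show "a \<in> A - {v}" using a by simp
    show "y \<in> A - {v}" if "x \<in> A - {v}" "x \<rightarrow>\<^bsub>pre_digraph.del_vert G v\<^esub> y" for x y
      using that A(3) by (auto simp: dominates_del_vert)
  qed
  then have *: "A - {v} = verts G - {v}" by (simp add: pre_digraph.del_vert_simps)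
  then have "w \<in> A" using w'(2,3) by blast
  then have "v \<in> A" using A(3) w'(4) by metis
  with * A(1) v show "A = verts G" by blast
qed

text \<open>Nonemptiness is carried along in the induction, since the unit sphere of the added
  vertex must be nonempty to attach it to the rest.\<close>

lemma contractible_connected: "contractible G \<Longrightarrow> verts G \<noteq> {} \<and> graph_connected G"
proof (induction rule: contractible.induct)
  case (one_point G)
  then show ?case by (auto simp: graph_connected_def card_1_singleton_iff)
next
  case (extend G v)
  then show ?case using graph_connected_extend[of G v] by auto
qed

lemma q_sphere_nonempty: "q_sphere q G \<Longrightarrow> q \<ge> 0 \<Longrightarrow> verts G \<noteq> {}"
  by (erule q_sphereE) auto

text \<open>From \<open>q = 1\<close> on, unit spheres are nonempty, so the vertex with contractible
  complement is attached to it. A 0-sphere, two isolated points, is not connected.\<close>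

lemma q_sphere_connected:
  assumes "q_sphere q G" "q \<ge> 1"
  shows "graph_connected G"
proof -
  obtain v where v: "v \<in> verts G" "contractible (pre_digraph.del_vert G v)"
    using q_sphereE[OF assms(1)] assms(2) by (metis order.trans zero_le_one)
  show ?thesis
    using graph_connected_extend[OF q_sphere_graph[OF assms(1)] v(1)]
      contractible_connected[OF v(2)] q_sphere_nonempty[OF q_sphere_links[OF assms(1) v(1)]] assms(2)
    by simp
qed


section \<open>Cross polytopes\<close>

text \<open>The complement of the graph is a perfect matching by antipodes. The parameter
  \<open>n\<close> counts antipodal pairs, so the dimension of the sphere is
  \<open>n - 1\<close>.\<close>

definition cross_polytope :: "nat \<Rightarrow> ('a,'b) pre_digraph \<Rightarrow> bool" where
  "cross_polytope n G \<longleftrightarrow> graph G \<and> card (verts G) = 2 * n \<and>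
    (\<forall>v\<in>verts G. \<exists>!w. w \<in> verts G \<and> w \<noteq> v \<and> \<not> v \<rightarrow>\<^bsub>G\<^esub> w)"

text \<open>Being non-adjacent is symmetric, so \<open>v\<close> is in turn the antipode of
  \<open>v'\<close> and the two have the same neighbours.\<close>

lemma cross_polytope_antipode:
  assumes "cross_polytope n G" "v \<in> verts G"
  obtains v' where "v' \<in> verts G" "v' \<noteq> v" "{w. v \<rightarrow>\<^bsub>G\<^esub> w} = verts G - {v, v'}"
    "{w. v' \<rightarrow>\<^bsub>G\<^esub> w} = verts G - {v, v'}"
proof -
  have gr: "graph G"
    and ex: "\<And>x. x \<in> verts G \<Longrightarrow> \<exists>!w. w \<in> verts G \<and> w \<noteq> x \<and> \<not> x \<rightarrow>\<^bsub>G\<^esub> w"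
    using assms(1) by (auto simp: cross_polytope_def)
  note D = graph_dominatesD[OF gr]
  obtain v' where v': "v' \<in> verts G" "v' \<noteq> v" "\<not> v \<rightarrow>\<^bsub>G\<^esub> v'"
    and uniq: "\<And>z. z \<in> verts G \<Longrightarrow> z \<noteq> v \<Longrightarrow> \<not> v \<rightarrow>\<^bsub>G\<^esub> z \<Longrightarrow> z = v'"
    using ex[OF assms(2)] by metis
  have nv: "\<not> v' \<rightarrow>\<^bsub>G\<^esub> v" using v'(3) D(4) by metis
  have uniq': "z = v" if "z \<in> verts G" "z \<noteq> v'" "\<not> v' \<rightarrow>\<^bsub>G\<^esub> z" for z
    using ex[OF v'(1)] nv v'(2) assms(2) that by metis
  show ?thesis
  proof (rule that[OF v'(1,2)])
    show "{w. v \<rightarrow>\<^bsub>G\<^esub> w} = verts G - {v, v'}"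
      using uniq v'(3) D(2) graph_irrefl[OF gr] by auto
    show "{w. v' \<rightarrow>\<^bsub>G\<^esub> w} = verts G - {v, v'}"
      using uniq' nv D(2) graph_irrefl[OF gr] by auto
  qed
qed

lemma cross_polytope_iso:
  assumes G: "cross_polytope n G" and iso: "digraph_iso G H" and H: "graph H"
  shows "cross_polytope n H"
proof -
  obtain f where f: "bij_betw f (verts G) (verts H)"
    "\<And>x y. x \<in> verts G \<Longrightarrow> y \<in> verts G \<Longrightarrow> f x \<rightarrow>\<^bsub>H\<^esub> f y \<longleftrightarrow> x \<rightarrow>\<^bsub>G\<^esub> y"
    using digraph_iso_imp_bij[OF iso] by blast
  have "\<exists>!w. w \<in> verts H \<and> w \<noteq> v \<and> \<not> v \<rightarrow>\<^bsub>H\<^esub> w" if "v \<in> verts H" for v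
  proof -
    have "v \<in> f ` verts G" using that bij_betw_imp_surj_on[OF f(1)] by simp
    then obtain x where x: "x \<in> verts G" "v = f x" by (rule imageE)
    from x(1) have "\<exists>!w. w \<in> verts G \<and> w \<noteq> x \<and> \<not> x \<rightarrow>\<^bsub>G\<^esub> w"
      using G by (simp add: cross_polytope_def)
    then obtain y where y: "y \<in> verts G" "y \<noteq> x" "\<not> x \<rightarrow>\<^bsub>G\<^esub> y"
      and uniq: "\<And>z. z \<in> verts G \<Longrightarrow> z \<noteq> x \<Longrightarrow> \<not> x \<rightarrow>\<^bsub>G\<^esub> z \<Longrightarrow> z = y"
      by metis
    show ?thesis
    proof (rule ex1I[of _ "f y"])
      show "f y \<in> verts H \<and> f y \<noteq> v \<and> \<not> v \<rightarrow>\<^bsub>H\<^esub> f y"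
        using x y f(2)[of x y] bij_betw_apply[OF f(1), of y]
          inj_on_eq_iff[OF bij_betw_imp_inj_on[OF f(1)], of y x] by simp
    next
      fix w assume w: "w \<in> verts H \<and> w \<noteq> v \<and> \<not> v \<rightarrow>\<^bsub>H\<^esub> w"
      then have "w \<in> f ` verts G" using bij_betw_imp_surj_on[OF f(1)] by simp
      then obtain z where z: "z \<in> verts G" "w = f z" by (rule imageE)
      then have "z \<noteq> x" "\<not> x \<rightarrow>\<^bsub>G\<^esub> z" using w x f(2)[of x z] by auto
      then show "w = f y" using uniq z by simp
    qed
  qed
  then show ?thesis
    using G H card_verts_iso[OF iso] by (simp add: cross_polytope_def)
qed

text \<open>Passing to the unit sphere of \<open>v\<close> removes exactly the pair of
  \<open>v\<close> and its antipode; all other antipodal pairs survive intact.\<close>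

lemma cross_polytope_unit_sphere:
  assumes G: "cross_polytope (Suc n) G" and v: "v \<in> verts G"
  shows "cross_polytope n (unit_sphere G v)"
proof -
  have gr: "graph G" and c: "card (verts G) = 2 * Suc n"
    using G by (auto simp: cross_polytope_def)
  note D = graph_dominatesD[OF gr]
  obtain v' where v': "v' \<in> verts G" "v' \<noteq> v" "{w. v \<rightarrow>\<^bsub>G\<^esub> w} = verts G - {v, v'}"
    "{w. v' \<rightarrow>\<^bsub>G\<^esub> w} = verts G - {v, v'}"
    using cross_polytope_antipode[OF G v] .
  have "card {w. v \<rightarrow>\<^bsub>G\<^esub> w} = 2 * n"
    using c v v' by (simp add: card_Diff_subset)
  moreover have "\<exists>!w. v \<rightarrow>\<^bsub>G\<^esub> w \<and> w \<noteq> x \<and> \<not> (v \<rightarrow>\<^bsub>G\<^esub> x \<and> v \<rightarrow>\<^bsub>G\<^esub> w \<and> x \<rightarrow>\<^bsub>G\<^esub> w)"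
    if x: "v \<rightarrow>\<^bsub>G\<^esub> x" for x
  proof -
    obtain x' where x': "x' \<in> verts G" "x' \<noteq> x" "{w. x \<rightarrow>\<^bsub>G\<^esub> w} = verts G - {x, x'}"
      using cross_polytope_antipode[OF G D(2)[OF x]] by metis
    have "x' \<noteq> v" using D(4)[OF x] x'(3) by auto
    moreover have "x' \<noteq> v'"
    proof -
      have "v' \<rightarrow>\<^bsub>G\<^esub> x" using x v'(3,4) by auto
      then show ?thesis using D(4) x'(3) by blast
    qed
    ultimately have "v \<rightarrow>\<^bsub>G\<^esub> x'" using v'(3) x'(1) by blast
    moreover have "\<not> x \<rightarrow>\<^bsub>G\<^esub> x'" using x'(3) by blast
    moreover have "w = x'" if "v \<rightarrow>\<^bsub>G\<^esub> w" "w \<noteq> x" "\<not> x \<rightarrow>\<^bsub>G\<^esub> w" for w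
      using that D(2)[OF that(1)] x'(3) by blast
    ultimately show ?thesis using x x'(2) by blast
  qed
  ultimately show ?thesis
    using graph_unit_sphere[OF gr]
    by (simp add: cross_polytope_def verts_unit_sphere dominates_unit_sphere)
qed

text \<open>It suffices to find for each \<open>v\<close> a vertex \<open>v'\<close> with the same
  neighbours; then \<open>v\<close>, \<open>v'\<close> and these neighbours form a closed set, which
  is everything by connectedness. The bound on \<open>n\<close> matters: for \<open>n = 1\<close>
  all cycles of length at least four satisfy the other hypotheses.\<close>

lemma cross_polytope_if_links:
  assumes G: "graph G" and conn: "graph_connected G" and ne: "verts G \<noteq> {}" and n: "n \<ge> 2"
    and links: "\<And>v. v \<in> verts G \<Longrightarrow> cross_polytope n (unit_sphere G v)"
  shows "cross_polytope (Suc n) G"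
proof -
  note D = graph_dominatesD[OF G]
  have deg: "card {w. v \<rightarrow>\<^bsub>G\<^esub> w} = 2 * n" if "v \<in> verts G" for v
    using links[OF that] by (simp add: cross_polytope_def verts_unit_sphere)
  have anti: "\<exists>!w. v \<rightarrow>\<^bsub>G\<^esub> w \<and> w \<noteq> x \<and> \<not> x \<rightarrow>\<^bsub>G\<^esub> w" if "v \<rightarrow>\<^bsub>G\<^esub> x" for v x
    using links[of v] that D(1)[OF that]
    by (auto simp: cross_polytope_def verts_unit_sphere dominates_unit_sphere)
  have fin: "finite {w. x \<rightarrow>\<^bsub>G\<^esub> w}" for x
    by (rule finite_subset[OF _ graph_finite_verts[OF G]]) (auto dest: D)
  have main: "\<exists>v'. v' \<noteq> v \<and> \<not> v \<rightarrow>\<^bsub>G\<^esub> v' \<and> {w. v' \<rightarrow>\<^bsub>G\<^esub> w} = {w. v \<rightarrow>\<^bsub>G\<^esub> w} \<and> verts G = {v, v'} \<union> {w. v \<rightarrow>\<^bsub>G\<^esub> w}"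
    if v: "v \<in> verts G" for v
  proof -
    let ?N = "{w. v \<rightarrow>\<^bsub>G\<^esub> w}"
    \<comment> \<open>\<open>star x\<close> is the antipode of \<open>v\<close> in the unit sphere
      of \<open>x\<close>, that is, the only neighbour of \<open>x\<close> outside the unit ball of
      \<open>v\<close>.\<close>
    define star where "star x = (THE w. x \<rightarrow>\<^bsub>G\<^esub> w \<and> w \<noteq> v \<and> \<not> v \<rightarrow>\<^bsub>G\<^esub> w)" for x
    have star: "x \<rightarrow>\<^bsub>G\<^esub> star x \<and> star x \<noteq> v \<and> \<not> v \<rightarrow>\<^bsub>G\<^esub> star x"
      and star_eq: "\<And>w. x \<rightarrow>\<^bsub>G\<^esub> w \<Longrightarrow> w \<noteq> v \<Longrightarrow> \<not> v \<rightarrow>\<^bsub>G\<^esub> w \<Longrightarrow> w = star x"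
      if "v \<rightarrow>\<^bsub>G\<^esub> x" for x
    proof -
      note a = anti[OF D(4)[OF that]]
      show "x \<rightarrow>\<^bsub>G\<^esub> star x \<and> star x \<noteq> v \<and> \<not> v \<rightarrow>\<^bsub>G\<^esub> star x"
        unfolding star_def by (rule theI'[OF a])
      then show "w = star x" if "x \<rightarrow>\<^bsub>G\<^esub> w" "w \<noteq> v" "\<not> v \<rightarrow>\<^bsub>G\<^esub> w" for w
        using a that by blast
    qed
    have step: "star x = star y" if x: "v \<rightarrow>\<^bsub>G\<^esub> x" and y: "v \<rightarrow>\<^bsub>G\<^esub> y" and xy: "x \<rightarrow>\<^bsub>G\<^esub> y" for x y
    proof -
      \<comment> \<open>In the sphere around \<open>x\<close> the vertex \<open>star x\<close> already has the antipode \<open>v\<close>.\<close>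
      have "star x \<rightarrow>\<^bsub>G\<^esub> y"
      proof (rule ccontr)
        assume "\<not> star x \<rightarrow>\<^bsub>G\<^esub> y"
        moreover have "\<not> star x \<rightarrow>\<^bsub>G\<^esub> v" using star[OF x] D(4) by metis
        moreover have "y \<noteq> star x" using star[OF x] y by metis
        moreover have "v \<noteq> y" "x \<rightarrow>\<^bsub>G\<^esub> v" using D(3)[OF y] D(4)[OF x] by simp_all
        ultimately show False using anti[of x "star x"] star[OF x] xy by metis
      qed
      then show ?thesis using star_eq[OF y] star[OF x] D(4) by blast
    qed
    have const: "star x = star y" if x: "v \<rightarrow>\<^bsub>G\<^esub> x" and y: "v \<rightarrow>\<^bsub>G\<^esub> y" for x y
    proof (cases "x = y \<or> x \<rightarrow>\<^bsub>G\<^esub> y")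
      case True
      then show ?thesis using step x y by blast
    next
      case False
      \<comment> \<open>Non-adjacent \<open>x\<close> and \<open>y\<close> are antipodes in the unit
        sphere of \<open>v\<close>. Since \<open>n \<ge> 2\<close> there is a third neighbour
        \<open>z\<close> of \<open>v\<close>, and it is adjacent to both.\<close>
      have "?N - {x, y} \<noteq> {}"
      proof
        assume "?N - {x, y} = {}"
        then have "card ?N \<le> card {x, y}" by (intro card_mono) auto
        also have "\<dots> \<le> 2" by (simp add: card_insert_if)
        finally show False using deg[OF v] n by simp
      qed
      then obtain z where z: "v \<rightarrow>\<^bsub>G\<^esub> z" "z \<noteq> x" "z \<noteq> y" by auto
      have "x \<rightarrow>\<^bsub>G\<^esub> z" using anti[OF x] False y z by metis
      moreover have "y \<rightarrow>\<^bsub>G\<^esub> z" using anti[OF y] False D(4) x z by metis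
      ultimately show ?thesis using step x y z by metis
    qed
    have "?N \<noteq> {}" using deg[OF v] n by (metis card.empty mult_eq_0_iff not_numeral_le_zero zero_neq_numeral)
    then obtain x where x: "v \<rightarrow>\<^bsub>G\<^esub> x" by auto
    define v' where "v' = star x"
    have v': "v' \<noteq> v" "\<not> v \<rightarrow>\<^bsub>G\<^esub> v'" "v' \<in> verts G"
      using star[OF x] D unfolding v'_def by blast+
    have sub: "?N \<subseteq> {w. v' \<rightarrow>\<^bsub>G\<^esub> w}"
      using star const[OF x] D(4) unfolding v'_def by auto
    \<comment> \<open>Both neighbourhoods have \<open>2 * n\<close> elements, so the inclusion is an
      equality.\<close>
    have eq: "?N = {w. v' \<rightarrow>\<^bsub>G\<^esub> w}"
      by (rule card_subset_eq[OF fin sub]) (simp add: deg v v')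
    \<comment> \<open>A neighbour of a vertex in \<open>?N\<close> is \<open>v\<close>, lies in
      \<open>?N\<close>, or is the common value \<open>v'\<close> of \<open>star\<close>; the
      neighbours of \<open>v\<close> and \<open>v'\<close> are \<open>?N\<close>.\<close>
    have "{v, v'} \<union> ?N = verts G"
    proof (rule graph_connectedD[OF conn])
      show "{v, v'} \<union> ?N \<subseteq> verts G" using v v' D by blast
      show "v \<in> {v, v'} \<union> ?N" by simp
      fix y z assume y: "y \<in> {v, v'} \<union> ?N" and yz: "y \<rightarrow>\<^bsub>G\<^esub> z"
      show "z \<in> {v, v'} \<union> ?N"
      proof (cases "v \<rightarrow>\<^bsub>G\<^esub> y")
        case True
        then show ?thesis using star_eq[OF True yz] const[OF x True] v'_def by auto
      next
        case False
        then show ?thesis using y yz eq by blast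
      qed
    qed
    then show ?thesis using v' eq by blast
  qed
  have "card (verts G) = 2 * Suc n"
  proof -
    obtain v where v: "v \<in> verts G" using ne by blast
    obtain v' where v': "v' \<noteq> v" "\<not> v \<rightarrow>\<^bsub>G\<^esub> v'" "verts G = {v, v'} \<union> {w. v \<rightarrow>\<^bsub>G\<^esub> w}"
      using main[OF v] by blast
    have "\<not> v \<rightarrow>\<^bsub>G\<^esub> v" using D(3) by blast
    then have "card ({v, v'} \<union> {w. v \<rightarrow>\<^bsub>G\<^esub> w}) = 2 + card {w. v \<rightarrow>\<^bsub>G\<^esub> w}"
      using v' fin by (subst card_Un_disjoint) auto
    then show ?thesis using v' deg[OF v] by simp
  qed
  moreover have "\<exists>!w. w \<in> verts G \<and> w \<noteq> v \<and> \<not> v \<rightarrow>\<^bsub>G\<^esub> w" if "v \<in> verts G" for v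
    using main[OF that] by blast
  ultimately show ?thesis using G by (simp add: cross_polytope_def)
qed

text \<open>For any vertex \<open>x\<close> other than the apex \<open>a\<close>, both the unit
  sphere of \<open>x\<close> and the graph without \<open>x\<close> are smaller cones with apex
  \<open>a\<close>.\<close>

lemma contractible_cone:
  assumes "graph G" "a \<in> verts G" "\<And>x. x \<in> verts G \<Longrightarrow> x \<noteq> a \<Longrightarrow> a \<rightarrow>\<^bsub>G\<^esub> x"
  shows "contractible G"
  using assms
proof (induction "card (verts G)" arbitrary: G rule: less_induct)
  case less
  note G = less.prems(1) note a = less.prems(2,3)
  note D = graph_dominatesD[OF G]
  have fin: "finite (verts G)" by (rule graph_finite_verts[OF G])
  show ?case
  proof (cases "verts G = {a}")
    case True
    then show ?thesis using G by (simp add: one_point)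
  next
    case False
    then obtain x where x: "x \<in> verts G" "x \<noteq> a" using a by blast
    then have ax: "a \<rightarrow>\<^bsub>G\<^esub> x" using a by blast
    have "contractible (unit_sphere G x)"
    proof (rule less.hyps[OF _ graph_unit_sphere[OF G]])
      show "card (verts (unit_sphere G x)) < card (verts G)"
        by (rule psubset_card_mono[OF fin]) (use x D(2) graph_irrefl[OF G, of x] in \<open>auto simp: verts_unit_sphere\<close>)
    qed (use ax a D(2,4) in \<open>auto simp: verts_unit_sphere dominates_unit_sphere\<close>)
    moreover have "contractible (pre_digraph.del_vert G x)"
    proof (rule less.hyps[OF _ graph_del_vert[OF G]])
      show "card (verts (pre_digraph.del_vert G x)) < card (verts G)"
        unfolding pre_digraph.verts_del_vert by (rule card_Diff1_less[OF fin x(1)])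
    qed (use x a in \<open>auto simp: pre_digraph.del_vert_simps dominates_del_vert\<close>)
    ultimately show ?thesis using extend[OF G x(1)] by blast
  qed
qed

section \<open>The standard cross polytope, uniqueness, and the Platonic property\<close>

text \<open>The antipodal pairs are \<open>2 * i\<close> and \<open>2 * i + 1\<close>, so
  \<open>div 2\<close> names the pair. An arc is the pair of its ends, which excludes parallel
  arcs.\<close>

definition standard_cross :: "nat \<Rightarrow> (nat, nat \<times> nat) pre_digraph" where
  "standard_cross n = \<lparr>verts = {..<2 * n},
    arcs = {(i, j). i < 2 * n \<and> j < 2 * n \<and> i div 2 \<noteq> j div 2}, tail = fst, head = snd\<rparr>"

lemma dominates_standard_cross:
  "i \<rightarrow>\<^bsub>standard_cross n\<^esub> j \<longleftrightarrow> i < 2 * n \<and> j < 2 * n \<and> i div 2 \<noteq> j div 2"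
  by (force simp: standard_cross_def arcs_ends_conv)

lemma graph_standard_cross: "graph (standard_cross n)"
proof -
  have "finite {(i, j). i < 2 * n \<and> j < 2 * n \<and> i div 2 \<noteq> j div 2}"
    by (rule finite_subset[of _ "{..<2 * n} \<times> {..<2 * n}"]) auto
  then show ?thesis
    by unfold_locales
      (auto simp: standard_cross_def arc_to_ends_def symmetric_conv)
qed

lemma cross_polytope_standard_cross: "cross_polytope n (standard_cross n)"
proof -
  have "\<exists>!w. w \<in> verts (standard_cross n) \<and> w \<noteq> v \<and> \<not> v \<rightarrow>\<^bsub>standard_cross n\<^esub> w"
    if "v \<in> verts (standard_cross n)" for v
  proof -
    have v: "v < 2 * n" using that by (simp add: standard_cross_def)
    then have "(w \<in> verts (standard_cross n) \<and> w \<noteq> v \<and> \<not> v \<rightarrow>\<^bsub>standard_cross n\<^esub> w) \<longleftrightarrow>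
        w < 2 * n \<and> w \<noteq> v \<and> w div 2 = v div 2" for w
      unfolding dominates_standard_cross by (auto simp: standard_cross_def)
    moreover have "(w < 2 * n \<and> w \<noteq> v \<and> w div 2 = v div 2) \<longleftrightarrow> w = (if even v then v + 1 else v - 1)" for w
    proof -
      define m where "m = v div 2"
      have w: "w div 2 = m \<longleftrightarrow> w = 2 * m \<or> w = 2 * m + 1" by linarith
      show ?thesis
      proof (cases "even v")
        case True
        then have "v = 2 * m" by (simp add: m_def)
        then show ?thesis using v True w by (auto simp: m_def)
      next
        case False
        then have "v = 2 * m + 1" by (simp add: m_def)
        then show ?thesis using v False w odd_pos[OF False] by (auto simp: m_def)
      qed
    qed
    ultimately show ?thesis by simp
  qed
  then show ?thesis
    using graph_standard_cross by (simp add: cross_polytope_def standard_cross_def)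
qed

text \<open>Every cross polytope can be labelled like the standard one: peel off a vertex
  \<open>v\<close> and its antipode, and label the unit sphere of \<open>v\<close> by
  induction.\<close>

lemma cross_polytope_param:
  assumes "cross_polytope n G"
  shows "\<exists>f. bij_betw f {..<2 * n} (verts G) \<and>
    (\<forall>i<2 * n. \<forall>j<2 * n. f i \<rightarrow>\<^bsub>G\<^esub> f j \<longleftrightarrow> i div 2 \<noteq> j div 2)"
  using assms
proof (induction n arbitrary: G)
  case 0
  then have "verts G = {}" using graph_finite_verts[of G] by (auto simp: cross_polytope_def)
  then show ?case by (simp add: bij_betw_def)
next
  case (Suc n)
  have gr: "graph G" using Suc.prems by (simp add: cross_polytope_def)
  note D = graph_dominatesD[OF gr]
  have "card (verts G) = 2 * Suc n" using Suc.prems by (simp add: cross_polytope_def)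
  then have "verts G \<noteq> {}" by auto
  then obtain v where v: "v \<in> verts G" by blast
  obtain v' where v': "v' \<in> verts G" "v' \<noteq> v" and N: "{w. v \<rightarrow>\<^bsub>G\<^esub> w} = verts G - {v, v'}"
    and N': "{w. v' \<rightarrow>\<^bsub>G\<^esub> w} = verts G - {v, v'}"
    using cross_polytope_antipode[OF Suc.prems v] .
  obtain f where f: "bij_betw f {..<2 * n} {w. v \<rightarrow>\<^bsub>G\<^esub> w}"
    and fE: "\<And>i j. i < 2 * n \<Longrightarrow> j < 2 * n \<Longrightarrow> f i \<rightarrow>\<^bsub>unit_sphere G v\<^esub> f j \<longleftrightarrow> i div 2 \<noteq> j div 2"
    using Suc.IH[OF cross_polytope_unit_sphere[OF Suc.prems v]] by (auto simp: verts_unit_sphere)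
  have fN: "v \<rightarrow>\<^bsub>G\<^esub> f i" "v' \<rightarrow>\<^bsub>G\<^esub> f i" if "i < 2 * n" for i
  proof -
    show "v \<rightarrow>\<^bsub>G\<^esub> f i" using f that by (auto simp: bij_betw_def)
    then show "v' \<rightarrow>\<^bsub>G\<^esub> f i" using N N' by blast
  qed
  have fE': "f i \<rightarrow>\<^bsub>G\<^esub> f j \<longleftrightarrow> i div 2 \<noteq> j div 2" if "i < 2 * n" "j < 2 * n" for i j
    using fE[OF that] fN that by (simp add: dominates_unit_sphere)
  \<comment> \<open>The peeled pair receives the two labels with \<open>div 2\<close> equal to
    \<open>n\<close>, which no earlier label has.\<close>
  let ?g = "f(2 * n := v, 2 * n + 1 := v')"
  have "bij_betw ?g ({..<2 * n} \<union> {2 * n, 2 * n + 1}) ({w. v \<rightarrow>\<^bsub>G\<^esub> w} \<union> {v, v'})"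
  proof (rule bij_betw_combine)
    show "bij_betw ?g {..<2 * n} {w. v \<rightarrow>\<^bsub>G\<^esub> w}"
      using f by (subst bij_betw_cong[of _ _ f]) auto
    show "bij_betw ?g {2 * n, 2 * n + 1} {v, v'}"
      using v' by (auto simp: bij_betw_def)
  qed (use N in auto)
  moreover have "{..<2 * n} \<union> {2 * n, 2 * n + 1} = {..<2 * Suc n}" by auto
  moreover have "{w. v \<rightarrow>\<^bsub>G\<^esub> w} \<union> {v, v'} = verts G" using N v v' by auto
  ultimately have bij: "bij_betw ?g {..<2 * Suc n} (verts G)" by simp
  have adj: "?g i \<rightarrow>\<^bsub>G\<^esub> ?g j \<longleftrightarrow> i div 2 \<noteq> j div 2" if ij: "i < 2 * Suc n" "j < 2 * Suc n" for i j
  proof -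
    have no: "\<not> v \<rightarrow>\<^bsub>G\<^esub> v" "\<not> v' \<rightarrow>\<^bsub>G\<^esub> v'" "\<not> v' \<rightarrow>\<^bsub>G\<^esub> v" "\<not> v \<rightarrow>\<^bsub>G\<^esub> v'"
      using N N' by blast+
    have cs: "k < 2 * n \<or> k = 2 * n \<or> k = 2 * n + 1" if "k < 2 * Suc n" for k using that by auto
    have dv: "k div 2 \<noteq> n" "n \<noteq> k div 2" if "k < 2 * n" for k using that by linarith+
    have fN': "f k \<rightarrow>\<^bsub>G\<^esub> v" "f k \<rightarrow>\<^bsub>G\<^esub> v'" if "k < 2 * n" for k
      using D(4)[OF fN(1)[OF that]] D(4)[OF fN(2)[OF that]] by simp_all
    show ?thesis
      using cs[OF ij(1)] cs[OF ij(2)] by (elim disjE) (simp_all add: fE' fN fN' no dv)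
  qed
  show ?case using bij adj by blast
qed

lemma cross_polytope_unique:
  assumes G: "cross_polytope n G" and H: "cross_polytope n H"
  shows "digraph_iso G H"
proof -
  obtain f where f: "bij_betw f {..<2 * n} (verts G)"
    "\<And>i j. i < 2 * n \<Longrightarrow> j < 2 * n \<Longrightarrow> f i \<rightarrow>\<^bsub>G\<^esub> f j \<longleftrightarrow> i div 2 \<noteq> j div 2"
    using cross_polytope_param[OF G] by blast
  obtain g where g: "bij_betw g {..<2 * n} (verts H)"
    "\<And>i j. i < 2 * n \<Longrightarrow> j < 2 * n \<Longrightarrow> g i \<rightarrow>\<^bsub>H\<^esub> g j \<longleftrightarrow> i div 2 \<noteq> j div 2"
    using cross_polytope_param[OF H] by blast
  let ?i = "inv_into {..<2 * n} f"
  have i: "?i x < 2 * n" "f (?i x) = x" if "x \<in> verts G" for x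
    using f(1) that bij_betw_inv_into_right[OF f(1) that] inv_into_into[of x f "{..<2 * n}"]
    by (auto simp: bij_betw_def)
  show ?thesis
  proof (rule bij_imp_digraph_iso)
    show "graph G" "graph H" using G H by (auto simp: cross_polytope_def)
    show "bij_betw (g \<circ> ?i) (verts G) (verts H)"
      using bij_betw_inv_into[OF f(1)] g(1) by (rule bij_betw_trans)
    show "(g \<circ> ?i) x \<rightarrow>\<^bsub>H\<^esub> (g \<circ> ?i) y \<longleftrightarrow> x \<rightarrow>\<^bsub>G\<^esub> y" if "x \<in> verts G" "y \<in> verts G" for x y
      using that i g(2)[of "?i x" "?i y"] f(2)[of "?i x" "?i y"] by simp
  qed
qed

text \<open>Deleting \<open>v\<close> leaves a cone whose apex is the antipode of \<open>v\<close>.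
  The unit spheres are smaller cross polytopes, hence Platonic by induction and isomorphic by
  uniqueness.\<close>

lemma platonic_cross_polytope: "cross_polytope n G \<Longrightarrow> platonic_sphere (int n - 1) G"
proof (induction n arbitrary: G)
  case 0
  then show ?case using graph_finite_verts[of G] by (auto simp: cross_polytope_def intro: platonic_empty)
next
  case (Suc n)
  have gr: "graph G" using Suc.prems by (simp add: cross_polytope_def)
  note D = graph_dominatesD[OF gr]
  have links: "platonic_sphere (int n - 1) (unit_sphere G v)" if "v \<in> verts G" for v
    using Suc.IH cross_polytope_unit_sphere[OF Suc.prems that] by blast
  have "q_manifold (int n) G"
    using gr links platonic_q_sphere by (intro manifold) auto
  moreover have "card (verts G) = 2 * Suc n" using Suc.prems by (simp add: cross_polytope_def)
  then have "verts G \<noteq> {}" by auto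
  then obtain v where v: "v \<in> verts G" by blast
  obtain v' where v': "v' \<in> verts G" "v' \<noteq> v" and N: "{w. v \<rightarrow>\<^bsub>G\<^esub> w} = verts G - {v, v'}"
    and N': "{w. v' \<rightarrow>\<^bsub>G\<^esub> w} = verts G - {v, v'}"
    using cross_polytope_antipode[OF Suc.prems v] .
  have "contractible (pre_digraph.del_vert G v)"
    by (rule contractible_cone[OF graph_del_vert[OF gr], of v'])
      (use v' N' in \<open>auto simp: pre_digraph.del_vert_simps dominates_del_vert\<close>)
  ultimately have "q_sphere (int n) G" using v by (blast intro: sphere)
  then have "platonic_sphere (int n) G"
    using links cross_polytope_unique[OF cross_polytope_unit_sphere cross_polytope_unit_sphere, OF Suc.prems _ Suc.prems]
    by (intro platonic) auto
  then show ?case by simp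
qed


section \<open>Platonic spheres of dimension at most four\<close>

text \<open>The Euler relation has only two terms here: one minus the number of vertices is
  \<open>-1\<close>.\<close>

lemma zero_sphere_card:
  assumes "q_sphere 0 G"
  shows "card (verts G) = 2"
proof -
  have "(\<Sum>k\<le>1. (-1) ^ k * int (num_cliques k G)) = (-1) ^ 1"
    by (rule sphere_euler_num_cliques) (use assms in simp)
  moreover have "{..1::nat} = {0, 1}" by auto
  ultimately have "int (num_cliques 0 G) - int (num_cliques 1 G) = -1" by simp
  then show ?thesis
    unfolding num_cliques_1 num_cliques_0[OF q_sphere_graph[OF assms]] by simp
qed

lemma one_sphere_degree:
  assumes "q_sphere 1 G" "v \<in> verts G"
  shows "card {w. v \<rightarrow>\<^bsub>G\<^esub> w} = 2"
  using zero_sphere_card[of "unit_sphere G v"] q_sphere_links[OF assms] by (simp add: verts_unit_sphere)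

lemma zero_sphere_no_edge:
  assumes "q_sphere 0 G"
  shows "\<not> x \<rightarrow>\<^bsub>G\<^esub> y"
proof
  assume xy: "x \<rightarrow>\<^bsub>G\<^esub> y"
  then have "q_sphere (-1) (unit_sphere G x)"
    using q_sphere_links[OF assms graph_dominatesD(1)[OF q_sphere_graph[OF assms] xy]] by simp
  then have "{w. x \<rightarrow>\<^bsub>G\<^esub> w} = {}" using q_sphere_minus_oneD by (simp flip: verts_unit_sphere)
  then show False using xy by blast
qed

text \<open>The neighbours \<open>a\<close> and \<open>b\<close> of \<open>v\<close> are not
  adjacent, because a 0-sphere has no edge. So the second neighbour of \<open>a\<close> is a fourth
  vertex.\<close>

lemma one_sphere_card_ge_4:
  assumes "q_sphere 1 G"
  shows "card (verts G) \<ge> 4"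
proof -
  have gr: "graph G" using assms by (rule q_sphere_graph)
  note D = graph_dominatesD[OF gr]
  obtain v where v: "v \<in> verts G" using q_sphere_nonempty[OF assms] by auto
  obtain a b where ab: "{w. v \<rightarrow>\<^bsub>G\<^esub> w} = {a, b}" "a \<noteq> b"
    using one_sphere_degree[OF assms v] unfolding card_2_iff by blast
  have va: "v \<rightarrow>\<^bsub>G\<^esub> a" and vb: "v \<rightarrow>\<^bsub>G\<^esub> b" using ab by auto
  have "q_sphere 0 (unit_sphere G v)" using q_sphere_links[OF assms v] by simp
  then have nab: "\<not> a \<rightarrow>\<^bsub>G\<^esub> b"
    using zero_sphere_no_edge va vb dominates_unit_sphere by metis
  obtain c where c: "a \<rightarrow>\<^bsub>G\<^esub> c" "c \<noteq> v"
  proof -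
    obtain c d where cd: "{w. a \<rightarrow>\<^bsub>G\<^esub> w} = {c, d}" "c \<noteq> d"
      using one_sphere_degree[OF assms D(2)[OF va]] unfolding card_2_iff by blast
    then have "a \<rightarrow>\<^bsub>G\<^esub> c" "a \<rightarrow>\<^bsub>G\<^esub> d" by auto
    then show ?thesis using that cd(2) by metis
  qed
  have "b \<noteq> c" using nab c(1) by metis
  then have "card {v, a, b, c} = 4"
    using c(2) ab(2) D(3)[OF va] D(3)[OF vb] D(3)[OF c(1)] by simp
  moreover have "{v, a, b, c} \<subseteq> verts G" using v D(2)[OF va] D(2)[OF vb] D(2)[OF c(1)] by simp
  then have "card {v, a, b, c} \<le> card (verts G)" by (rule card_mono[OF graph_finite_verts[OF gr]])
  ultimately show ?thesis by simp
qed

text \<open>With degree two among four vertices, each vertex has exactly one non-neighbour besides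
  itself.\<close>

lemma one_sphere_4_cross_polytope:
  assumes "q_sphere 1 G" "card (verts G) = 4"
  shows "cross_polytope 2 G"
proof -
  have gr: "graph G" using assms(1) by (rule q_sphere_graph)
  note D = graph_dominatesD[OF gr]
  have "\<exists>!w. w \<in> verts G \<and> w \<noteq> v \<and> \<not> v \<rightarrow>\<^bsub>G\<^esub> w" if v: "v \<in> verts G" for v
  proof -
    let ?N = "{w. v \<rightarrow>\<^bsub>G\<^esub> w}"
    have "insert v ?N \<subseteq> verts G" using D(2) v by auto
    moreover have "v \<notin> ?N" using graph_irrefl[OF gr] by simp
    moreover have "finite ?N" using one_sphere_degree[OF assms(1) v] by (simp add: card_ge_0_finite)
    ultimately have "card (verts G - insert v ?N) = 1"
      using one_sphere_degree[OF assms(1) v] assms(2) by (simp add: card_Diff_subset)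
    then obtain w where "verts G - insert v ?N = {w}" by (rule card_1_singletonE)
    then show ?thesis by (intro ex1I[of _ w]) auto
  qed
  then show ?thesis using gr assms(2) by (simp add: cross_polytope_def)
qed

lemma one_sphere_num_edges:
  assumes "q_sphere 1 G"
  shows "num_cliques 2 G = card (verts G)"
proof -
  have "num_cliques 1 (unit_sphere G v) = 2" if "v \<in> verts G" for v
    unfolding num_cliques_1 using q_sphere_links[OF assms that] by (intro zero_sphere_card) simp
  then show ?thesis
    using num_cliques_Suc[OF q_sphere_graph[OF assms], of 1] by (simp add: numeral_2_eq_2)
qed

text \<open>The second alternative belongs to the icosahedron.\<close>

lemma platonic_2_sphere_cases:
  assumes "platonic_sphere 2 G"
  shows "cross_polytope 3 G \<or>
    (num_cliques 1 G = 12 \<and> num_cliques 2 G = 30 \<and> num_cliques 3 G = 20)"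
proof -
  have sph: "q_sphere 2 G" using assms by (rule platonic_q_sphere)
  then have gr: "graph G" by (rule q_sphere_graph)
  have links: "q_sphere 1 (unit_sphere G v)" if "v \<in> verts G" for v
    using q_sphere_links[OF sph that] by simp
  obtain v where v: "v \<in> verts G" using q_sphere_nonempty[OF sph] by auto
  define n where "n = card (verts G)"
  \<comment> \<open>All unit spheres are isomorphic, so \<open>k\<close> is the degree of every
    vertex.\<close>
  define k where "k = card (verts (unit_sphere G v))"
  have k: "card (verts (unit_sphere G w)) = k" if "w \<in> verts G" for w
    unfolding k_def using platonic_sphereD(2)[OF assms _ that v] by (auto dest: card_verts_iso)
  have "num_cliques 1 (unit_sphere G w) = k" if "w \<in> verts G" for w
    unfolding num_cliques_1 by (rule k[OF that])
  then have "2 * num_cliques 2 G = n * k"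
    using num_cliques_Suc[OF gr, of 1] by (simp add: numeral_2_eq_2 n_def)
  \<comment> \<open>A 1-sphere has as many edges as vertices, so \<open>n * k\<close> also counts
    each triangle three times.\<close>
  moreover have "num_cliques 2 (unit_sphere G w) = k" if "w \<in> verts G" for w
    using one_sphere_num_edges[OF links[OF that]] k[OF that] by simp
  then have "3 * num_cliques 3 G = n * k"
    using num_cliques_Suc[OF gr, of 2] by (simp add: numeral_3_eq_3 n_def)
  moreover have "1 - int n + int (num_cliques 2 G) - int (num_cliques 3 G) = -1"
  proof -
    have "(\<Sum>k\<le>3. (-1) ^ k * int (num_cliques k G)) = (-1) ^ 3"
      by (rule sphere_euler_num_cliques) (use sph in simp)
    moreover have "{..3::nat} = {0, 1, 2, 3}" by auto
    ultimately have "int (num_cliques 0 G) - int (num_cliques 1 G) + int (num_cliques 2 G)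
        - int (num_cliques 3 G) = -1"
      by simp
    then show ?thesis unfolding num_cliques_0[OF gr] num_cliques_1 n_def by simp
  qed
  \<comment> \<open>Inserting \<open>n * k / 2\<close> edges and \<open>n * k / 3\<close> triangles
    into the Euler relation gives \<open>n * (6 - k) = 12\<close>. Hence \<open>k < 6\<close>; with
    \<open>k \<ge> 4\<close> only 4 (octahedron) and 5 (\<open>n = 12\<close>) remain.\<close>
  ultimately have f: "2 * num_cliques 2 G = n * k" "3 * num_cliques 3 G = n * k"
    and eq: "n * 6 = n * k + 12" by linarith+
  have "k < 6"
  proof (rule ccontr)
    assume "\<not> k < 6"
    then have "n * 6 \<le> n * k" by (intro mult_le_mono2) simp
    then show False using eq by simp
  qed
  moreover have "k \<ge> 4" using one_sphere_card_ge_4[OF links[OF v]] by (simp add: k_def)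
  ultimately consider "k = 4" | "k = 5" by linarith
  then show ?thesis
  proof cases
    case 1
    then have "cross_polytope 2 (unit_sphere G w)" if "w \<in> verts G" for w
      using k[OF that] by (intro one_sphere_4_cross_polytope links[OF that]) simp
    then have "cross_polytope (Suc 2) G"
      using v by (intro cross_polytope_if_links[OF gr q_sphere_connected[OF sph]]) auto
    then show ?thesis by simp
  next
    case 2
    then have "num_cliques 1 G = 12" using eq num_cliques_1[of G] by (simp add: n_def)
    then show ?thesis using f eq 2 by simp
  qed
qed

text \<open>The unit spheres of a Platonic sphere are isomorphic to each other, so a single one that
  is a cross polytope decides all of them.\<close>

lemma platonic_cross_polytope_if_link:
  assumes G: "platonic_sphere q G" and q: "q \<ge> 1" and n: "n \<ge> 2"
    and v: "v \<in> verts G" "cross_polytope n (unit_sphere G v)"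
  shows "cross_polytope (Suc n) G"
proof -
  have sph: "q_sphere q G" using G by (rule platonic_q_sphere)
  then have gr: "graph G" by (rule q_sphere_graph)
  have "cross_polytope n (unit_sphere G w)" if "w \<in> verts G" for w
    using q by (intro cross_polytope_iso[OF v(2)] platonic_sphereD(2)[OF G _ v(1) that]
        graph_unit_sphere[OF gr]) simp
  then show ?thesis
    using cross_polytope_if_links[OF gr q_sphere_connected[OF sph q] _ n] v(1) by blast
qed

text \<open>The second alternative belongs to the 600-cell.\<close>

lemma platonic_3_sphere_cases:
  assumes "platonic_sphere 3 G"
  shows "cross_polytope 4 G \<or> (num_cliques 1 G > 12 \<and> num_cliques 2 G = 6 * num_cliques 1 G \<and>
    num_cliques 3 G = 10 * num_cliques 1 G \<and> num_cliques 4 G = 5 * num_cliques 1 G)"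
proof (cases "\<exists>v\<in>verts G. cross_polytope 3 (unit_sphere G v)")
  case True
  then have "cross_polytope (Suc 3) G" using platonic_cross_polytope_if_link[OF assms, of 3] by auto
  then show ?thesis by simp
next
  case False
  have sph: "q_sphere 3 G" using assms by (rule platonic_q_sphere)
  then have gr: "graph G" by (rule q_sphere_graph)
  have f: "num_cliques 1 (unit_sphere G v) = 12" "num_cliques 2 (unit_sphere G v) = 30"
    "num_cliques 3 (unit_sphere G v) = 20" if "v \<in> verts G" for v
    using platonic_2_sphere_cases[of "unit_sphere G v"] platonic_sphereD(1)[OF assms _ that] False that
    by auto
  obtain v where v: "v \<in> verts G" using q_sphere_nonempty[OF sph] by auto
  \<comment> \<open>Together with \<open>v\<close> the 12 vertices of its unit sphere give more than
    12. In dimension four this bound excludes a graph with two vertices.\<close>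
  have "verts (unit_sphere G v) \<subset> verts G"
    using v graph_dominatesD(2)[OF gr] graph_irrefl[OF gr, of v] by (auto simp: verts_unit_sphere)
  then have "card (verts G) > 12"
    using f(1)[OF v] psubset_card_mono[OF graph_finite_verts[OF gr], of "verts (unit_sphere G v)"]
    by (simp add: num_cliques_1[unfolded One_nat_def])
  \<comment> \<open>Double counting gives \<open>12/2\<close>, \<open>30/3\<close> and
    \<open>20/4\<close> cliques per vertex. The Euler relation of a 3-sphere then holds for every
    number of vertices, so no contradiction arises yet.\<close>
  moreover have "2 * num_cliques 2 G = card (verts G) * 12"
    using num_cliques_Suc[OF gr, of 1] f(1) by (simp add: numeral_2_eq_2)
  moreover have "3 * num_cliques 3 G = card (verts G) * 30"
    using num_cliques_Suc[OF gr, of 2] f(2) by (simp add: numeral_3_eq_3)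
  moreover have "4 * num_cliques 4 G = card (verts G) * 20"
    using num_cliques_Suc[OF gr, of 3] f(3) by simp
  ultimately show ?thesis using num_cliques_1[of G] by linarith
qed

text \<open>The Euler characteristic of a 4-sphere whose unit spheres have the clique counts of the
  600-cell equals its number of vertices, so there would be only two of them.\<close>

lemma platonic_4_sphere_cross_polytope:
  assumes "platonic_sphere 4 G"
  shows "cross_polytope 5 G"
proof (cases "\<exists>v\<in>verts G. cross_polytope 4 (unit_sphere G v)")
  case True
  then have "cross_polytope (Suc 4) G" using platonic_cross_polytope_if_link[OF assms, of 4] by auto
  then show ?thesis by simp
next
  case False
  have sph: "q_sphere 4 G" using assms by (rule platonic_q_sphere)
  then have gr: "graph G" by (rule q_sphere_graph)
  let ?m = "\<lambda>v. num_cliques 1 (unit_sphere G v)"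
  have f: "?m v > 12" "num_cliques 2 (unit_sphere G v) = 6 * ?m v"
    "num_cliques 3 (unit_sphere G v) = 10 * ?m v" "num_cliques 4 (unit_sphere G v) = 5 * ?m v"
    if "v \<in> verts G" for v
    using platonic_3_sphere_cases[of "unit_sphere G v"] platonic_sphereD(1)[OF assms _ that] False that
    by auto
  \<comment> \<open>\<open>M\<close> is the sum of the degrees; every clique count from edges
    upwards is a multiple of it.\<close>
  define M where "M = (\<Sum>v\<in>verts G. ?m v)"
  obtain v where v: "v \<in> verts G" using q_sphere_nonempty[OF sph] by auto
  have "verts (unit_sphere G v) \<subseteq> verts G"
    using graph_dominatesD[OF gr] by (auto simp: verts_unit_sphere)
  then have "card (verts G) > 12"
    using f(1)[OF v] card_mono[OF graph_finite_verts[OF gr]]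
    by (metis num_cliques_1 less_le_trans)
  moreover have "2 * num_cliques 2 G = M"
    using num_cliques_Suc[OF gr, of 1] by (simp add: numeral_2_eq_2 M_def)
  moreover have "3 * num_cliques 3 G = 6 * M"
    using num_cliques_Suc[OF gr, of 2] f(2) by (simp add: numeral_3_eq_3 M_def sum_distrib_left)
  moreover have "4 * num_cliques 4 G = 10 * M"
    using num_cliques_Suc[OF gr, of 3] f(3) by (simp add: M_def sum_distrib_left)
  moreover have "5 * num_cliques 5 G = 5 * M"
    using num_cliques_Suc[OF gr, of 4] f(4) by (simp add: M_def sum_distrib_left)
  \<comment> \<open>With \<open>M/2\<close> edges, \<open>2M\<close> triangles, \<open>5M/2\<close>
    cliques of size four and \<open>M\<close> of size five, the terms in \<open>M\<close> cancel.
    What remains is \<open>card (verts G) = 2\<close>, against the bound of more than 12.\<close>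
  moreover have "1 - int (card (verts G)) + int (num_cliques 2 G) - int (num_cliques 3 G)
      + int (num_cliques 4 G) - int (num_cliques 5 G) = -1"
  proof -
    have "(\<Sum>k\<le>5. (-1) ^ k * int (num_cliques k G)) = (-1) ^ 5"
      by (rule sphere_euler_num_cliques) (use sph in simp)
    moreover have "{..5::nat} = {0, 1, 2, 3, 4, 5}" by auto
    ultimately have "int (num_cliques 0 G) - int (num_cliques 1 G) + int (num_cliques 2 G)
        - int (num_cliques 3 G) + int (num_cliques 4 G) - int (num_cliques 5 G) = -1"
      by simp
    then show ?thesis unfolding num_cliques_0[OF gr] num_cliques_1 by simp
  qed
  ultimately have False by linarith
  then show ?thesis ..
qed

section \<open>Classification from dimension four on\<close>

text \<open>The induction starts at dimension four, where no exceptional alternative is left. Above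
  it, a unit sphere is a cross polytope by induction, and one such unit sphere suffices.\<close>

lemma platonic_sphere_cross_polytope:
  "n \<ge> 5 \<Longrightarrow> platonic_sphere (int n - 1) G \<Longrightarrow> cross_polytope n G"
proof (induction n arbitrary: G rule: dec_induct)
  case base
  then show ?case using platonic_4_sphere_cross_polytope by simp
next
  case (step n)
  then have G: "platonic_sphere (int n) G" by simp
  obtain v where v: "v \<in> verts G"
    using q_sphere_nonempty[OF platonic_q_sphere[OF G]] by auto
  then have "cross_polytope n (unit_sphere G v)"
    using step.IH platonic_sphereD(1)[OF G] by simp
  then show ?case using platonic_cross_polytope_if_link[OF G _ _ v] step.hyps by simp
qed

theorem mainTheorem5:
  fixes q :: int
  assumes "q > 3"
  shows "(\<exists>G :: (nat, nat \<times> nat) pre_digraph. platonic_sphere q G) \<and>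
    (\<forall>(G :: ('a,'b) pre_digraph) (H :: ('c,'d) pre_digraph).
      platonic_sphere q G \<longrightarrow> platonic_sphere q H \<longrightarrow> digraph_iso G H)"
proof -
  \<comment> \<open>The number of antipodal pairs is one more than the dimension, so
    \<open>q > 3\<close> becomes \<open>n \<ge> 5\<close>.\<close>
  define n where "n = nat (q + 1)"
  have n: "q = int n - 1" "n \<ge> 5" using assms by (auto simp: n_def)
  show ?thesis
  proof (intro conjI exI allI impI)
    show "platonic_sphere q (standard_cross n)"
      unfolding n(1) by (rule platonic_cross_polytope[OF cross_polytope_standard_cross])
    fix G :: "('a,'b) pre_digraph" and H :: "('c,'d) pre_digraph"
    assume "platonic_sphere q G" "platonic_sphere q H"
    then show "digraph_iso G H"
      unfolding n(1) by (intro cross_polytope_unique[of n] platonic_sphere_cross_polytope[OF n(2)])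
  qed
qed

end
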